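(* Let $(M,d)$ be a continuous metric space (any pair of points is connected by a continuous shortest path), let $n\ge 1$, let $\hat o\in M$ be the prediction, and let $\Delta\ge 0$ be a constant. Then for any true locations $\boldsymbol{\ell}=(\ell_1,\dots,\ell_n)\in M^n$ of the $n$ agents, the game induced by the mechanism $\mathrm{Harmonic}(\Delta)$ with prediction $\hat o$ has a Pure Nash Equilibrium $(\tilde\ell_1,\dots,\tilde\ell_n)\in M^n$.
   Context: A continuous shortest path between $P,Q\in M$ is a map $\gamma:[0,d(P,Q)]\to M$ with $\gamma(0)=P$, $\gamma(d(P,Q))=Q$ and $d(\gamma(s),\gamma(t))=|s-t|$ for all $s,t$. Mechanism $\mathrm{Harmonic}(\Delta)$: given reports $\tilde{\boldsymbol\ell}=(\tilde\ell_1,\dots,\tilde\ell_n)\in M^n$ and the prediction $\hat o$, the facility is placed at $\tilde\ell_j$ with probability $$\frac{1/(d(\tilde\ell_j,\hat o)+\Delta)}{\sum_{k=1}^n 1/(d(\tilde\ell_k,\hat o)+\Delta)},\qquad j\in[n].$$ (No separate convention is stated for the case $\Delta=0$ with a report equal to $\hat o$.) In the induced game each agent $i$ chooses a report $\tilde\ell_i\in M$, and the cost of agent $i$ is the expected distance from the true location $\ell_i$ to the facility: $$\mathrm{cost}_i(\tilde{\boldsymbol\ell})=\frac{\sum_{j\in[n]} d(\ell_i,\tilde\ell_j)/(d(\tilde\ell_j,\hat o)+\Delta)}{\sum_{j\in[n]}1/(d(\tilde\ell_j,\hat o)+\Delta)}.$$ A Pure Nash Equilibrium is a profile $\tilde{\boldsymbol\ell}\in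 M^n$ such that $\mathrm{cost}_i(\tilde{\boldsymbol\ell})\le \mathrm{cost}_i(\tilde\ell_i',\tilde{\boldsymbol\ell}_{-i})$ for every $i\in[n]$ and every $\tilde\ell_i'\in M$.
   Formalization: For Δ = 0 and some report equal to ô, where the stated probabilities are undefined (division by zero), the facility is placed at ô with probability 1 (uniformly among the agents reporting ô), the limit of the stated probabilities as Δ → 0+. *)

theory Defs
  imports "HOL-Analysis.Analysis"
begin

definition shortest_path_between ::
    "'a set \<Rightarrow> ('a \<Rightarrow> 'a \<Rightarrow> real) \<Rightarrow> 'a \<Rightarrow> 'a \<Rightarrow> (real \<Rightarrow> 'a) \<Rightarrow> bool" where
  "shortest_path_between M d P Q \<gamma> \<longleftrightarrow>
     \<gamma> \<in> {0..d P Q} \<rightarrow> M \<and> \<gamma> 0 = P \<and> \<gamma> (d P Q) = Q \<and>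
     (\<forall>s\<in>{0..d P Q}. \<forall>t\<in>{0..d P Q}. d (\<gamma> s) (\<gamma> t) = \<bar>s - t\<bar>)"

definition continuous_metric_space :: "'a set \<Rightarrow> ('a \<Rightarrow> 'a \<Rightarrow> real) \<Rightarrow> bool" where
  "continuous_metric_space M d \<longleftrightarrow>
     Metric_space M d \<and> (\<forall>P\<in>M. \<forall>Q\<in>M. \<exists>\<gamma>. shortest_path_between M d P Q \<gamma>)"

text \<open>
  The agents are \<open>1, \<dots>, n\<close> and \<open>r j\<close> is the report of agent \<open>j\<close>; values of a profile
  outside \<open>{1..n}\<close> are irrelevant. \<open>harmonic_prob d n \<Delta> p r j\<close> is the probability that the
  mechanism with prediction \<open>p\<close> selects the report of agent \<open>j\<close>.

  If \<open>\<Delta> = 0\<close> and some report equals \<open>p\<close>, a summand \<open>1/0\<close> occurs in the harmonic formula. In that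
  case the mechanism picks uniformly among the agents reporting \<open>p\<close>, so the facility is at \<open>p\<close>
  with probability 1. This is the limit of the formula as \<open>\<Delta>\<close> decreases to 0. (Evaluating the
  formula with HOL's \<open>1/0 = 0\<close> would instead ignore precisely the reports at \<open>p\<close>, and would not
  give a probability distribution when all reports are at \<open>p\<close>.)
\<close>

definition harmonic_prob ::
    "('a \<Rightarrow> 'a \<Rightarrow> real) \<Rightarrow> nat \<Rightarrow> real \<Rightarrow> 'a \<Rightarrow> (nat \<Rightarrow> 'a) \<Rightarrow> nat \<Rightarrow> real" where
  "harmonic_prob d n \<Delta> p r j =
     (let Z = {k \<in> {1..n}. d (r k) p + \<Delta> = 0} in
      if Z = {} then (1 / (d (r j) p + \<Delta>)) / (\<Sum>k\<in>{1..n}. 1 / (d (r k) p + \<Delta>))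
      else if j \<in> Z then 1 / real (card Z) else 0)"

text \<open>Expected distance from the true location \<open>l i\<close> of agent \<open>i\<close> to the facility.\<close>

definition harmonic_cost ::
    "('a \<Rightarrow> 'a \<Rightarrow> real) \<Rightarrow> nat \<Rightarrow> real \<Rightarrow> 'a \<Rightarrow> (nat \<Rightarrow> 'a) \<Rightarrow> nat \<Rightarrow> (nat \<Rightarrow> 'a) \<Rightarrow> real" where
  "harmonic_cost d n \<Delta> p l i r = (\<Sum>j\<in>{1..n}. harmonic_prob d n \<Delta> p r j * d (l i) (r j))"

definition pure_nash_equilibrium ::
    "'a set \<Rightarrow> nat \<Rightarrow> (nat \<Rightarrow> (nat \<Rightarrow> 'a) \<Rightarrow> real) \<Rightarrow> (nat \<Rightarrow> 'a) \<Rightarrow> bool" where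
  "pure_nash_equilibrium S n cost r \<longleftrightarrow>
     r \<in> {1..n} \<rightarrow> S \<and> (\<forall>i\<in>{1..n}. \<forall>x\<in>S. cost i r \<le> cost i (r(i := x)))"

lemma harmonic_cost_regular:
  assumes "\<And>k. k \<in> {1..n} \<Longrightarrow> d (r k) p + \<Delta> \<noteq> 0"
  shows "harmonic_cost d n \<Delta> p l i r =
    (\<Sum>j\<in>{1..n}. d (l i) (r j) / (d (r j) p + \<Delta>)) / (\<Sum>j\<in>{1..n}. 1 / (d (r j) p + \<Delta>))"
proof -
  have "{k \<in> {1..n}. d (r k) p + \<Delta> = 0} = {}"
    using assms by blast
  then show ?thesis
    by (simp add: harmonic_cost_def harmonic_prob_def sum_divide_distrib)
qed

lemma harmonic_cost_singular:
  assumes M: "Metric_space M d" "p \<in> M" "r \<in> {1..n} \<rightarrow> M"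
    and k: "k \<in> {1..n}" "r k = p"
  shows "harmonic_cost d n 0 p l i r = d (l i) p"
proof -
  define Z where "Z = {k \<in> {1..n}. d (r k) p + 0 = 0}"
  have Z: "j \<in> Z \<longleftrightarrow> j \<in> {1..n} \<and> r j = p" for j
    using Metric_space.zero[OF M(1)] M(2,3) by (auto simp: Z_def Pi_iff)
  have fin: "finite Z" and ne: "Z \<noteq> {}"
    using k Z by (auto simp: Z_def)
  have "harmonic_cost d n 0 p l i r = (\<Sum>j\<in>{1..n}. if j \<in> Z then 1 / real (card Z) * d (l i) p else 0)"
    unfolding harmonic_cost_def harmonic_prob_def Let_def Z_def[symmetric]
    using ne Z by (intro sum.cong) auto
  also have "\<dots> = (\<Sum>j\<in>Z. 1 / real (card Z) * d (l i) p)"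
    using Z by (intro sum.mono_neutral_cong_right) auto
  also have "\<dots> = d (l i) p"
    using fin ne by simp
  finally show ?thesis .
qed

lemma harmonic_prob_sum:
  assumes "Metric_space M d" "n \<ge> 1" "\<Delta> \<ge> 0"
  shows "(\<Sum>j\<in>{1..n}. harmonic_prob d n \<Delta> p r j) = 1"
proof -
  define Z where "Z = {k \<in> {1..n}. d (r k) p + \<Delta> = 0}"
  show ?thesis
  proof (cases "Z = {}")
    case True
    have "1 / (d (r k) p + \<Delta>) > 0" if "k \<in> {1..n}" for k
    proof -
      have "d (r k) p + \<Delta> \<noteq> 0" using True that by (auto simp: Z_def)
      moreover have "d (r k) p + \<Delta> \<ge> 0"
        using Metric_space.nonneg[OF assms(1)] assms(3) by (simp add: add_nonneg_nonneg)
      ultimately show ?thesis by simp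
    qed
    then have "(\<Sum>k\<in>{1..n}. 1 / (d (r k) p + \<Delta>)) > 0"
      using assms(2) by (intro sum_pos) auto
    then show ?thesis
      unfolding harmonic_prob_def Let_def Z_def[symmetric] using True
      by (simp only: simp_thms if_True flip: sum_divide_distrib) simp
  next
    case False
    have "(\<Sum>j\<in>{1..n}. harmonic_prob d n \<Delta> p r j) = (\<Sum>j\<in>Z. 1 / real (card Z))"
      unfolding harmonic_prob_def Let_def Z_def[symmetric] using False
      by (intro sum.mono_neutral_cong_right) (auto simp: Z_def)
    also have "\<dots> = 1"
      using False by (simp add: Z_def)
    finally show ?thesis .
  qed
qed

end

theory Submission
  imports Defs
begin

text \<open>
  Restrict agent \<open>i\<close> to a shortest path from the prediction \<open>p\<close> to her location, of length \<open>D\<close>.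
  Against fixed reports of the others, her cost at distance \<open>t\<close> from \<open>p\<close> is a linear fractional
  function of \<open>t\<close>, hence monotone, with a direction that depends continuously on the other reports.
  By the triangle inequality no report off the path beats the best one on it. So an equilibrium is
  a point of a cube at which each of \<open>n\<close> continuous slopes vanishes unless the point lies on the
  face towards which the slope pushes; such a point exists by Kuhn's cubical form of
  Sperner's lemma and compactness. The case \<open>\<Delta> = 0\<close> is degenerate: if \<open>n \<ge> 2\<close> and everyone reports \<open>p\<close>, then no
  single agent can move the facility.
\<close>

section \<open>Complementarity points in the unit cube\<close>

text \<open>On the grid of mesh \<open>1 / p\<close>, Kuhn's lemma finds a cell in which every
  coordinate receives both labels. The corners \<open>a\<close> and \<open>b\<close> carrying them
  may differ from one coordinate to the next, but all lie within one mesh width of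
  \<open>y\<close>.\<close>

lemma unit_cube_grid_approx:
  fixes n p :: nat and g :: "nat \<Rightarrow> (nat \<Rightarrow> real) \<Rightarrow> real"
  assumes "0 < p"
  obtains y where "\<forall>j<n. y j \<in> {0..1}"
    "\<forall>i<n. \<exists>a. (\<forall>j<n. a j \<in> {0..1} \<and> \<bar>a j - y j\<bar> \<le> 1 / p) \<and> (a i = 0 \<or> g i a \<le> 0)"
    "\<forall>i<n. \<exists>b. (\<forall>j<n. b j \<in> {0..1} \<and> \<bar>b j - y j\<bar> \<le> 1 / p) \<and> (b i = 1 \<or> g i b \<ge> 0)"
proof -
  define sc :: "(nat \<Rightarrow> nat) \<Rightarrow> nat \<Rightarrow> real" where "sc x j = x j / p" for x j
  \<comment> \<open>Inside the cube the label records whether the slope is positive. The tests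
    against \<open>0\<close> and \<open>p\<close> force label 0 on the lower face and 1 on the upper
    one, as Kuhn's lemma demands; they become the alternatives \<open>a i = 0\<close> and
    \<open>b i = 1\<close>.\<close>
  define lab :: "(nat \<Rightarrow> nat) \<Rightarrow> nat \<Rightarrow> nat"
    where "lab x i = (if x i \<noteq> 0 \<and> (x i = p \<or> g i (sc x) > 0) then 1 else 0)" for x i
  obtain q where q: "\<forall>i<n. q i < p"
    and rs: "\<forall>i<n. \<exists>r s. (\<forall>j<n. q j \<le> r j \<and> r j \<le> q j + 1) \<and>
      (\<forall>j<n. q j \<le> s j \<and> s j \<le> q j + 1) \<and> lab r i \<noteq> lab s i"
    by (rule kuhn_lemma[OF assms, of n lab]) (use assms in \<open>auto simp: lab_def\<close>)
  have lab01: "lab x i = 0 \<or> lab x i = 1" for x i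
    by (simp add: lab_def)
  have near: "sc r j \<in> {0..1} \<and> \<bar>sc r j - sc q j\<bar> \<le> 1 / p"
    if "\<forall>j<n. q j \<le> r j \<and> r j \<le> q j + 1" "j < n" for r j
  proof -
    have "q j \<le> r j" "r j \<le> q j + 1" "r j \<le> p"
      using that q by (auto simp: Suc_leI le_trans)
    then show ?thesis
      using assms by (auto simp: sc_def divide_simps abs_if)
  qed
  show ?thesis
  proof (rule that[of "sc q"]; intro allI impI)
    show "sc q j \<in> {0..1}" if "j < n" for j
      using near[of q j] that by simp
  next
    fix i assume i: "i < n"
    obtain r where r: "\<forall>j<n. q j \<le> r j \<and> r j \<le> q j + 1" "lab r i = 0"
      using rs i lab01[of _ i] by metis
    moreover have "sc r i = 0 \<or> g i (sc r) \<le> 0"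
      using r(2) by (auto simp: lab_def sc_def split: if_splits)
    ultimately show "\<exists>a. (\<forall>j<n. a j \<in> {0..1} \<and> \<bar>a j - sc q j\<bar> \<le> 1 / p) \<and> (a i = 0 \<or> g i a \<le> 0)"
      using near by (intro exI[of _ "sc r"]) blast
  next
    fix i assume i: "i < n"
    obtain s where s: "\<forall>j<n. q j \<le> s j \<and> s j \<le> q j + 1" "lab s i = 1"
      using rs i lab01[of _ i] by metis
    moreover have "sc s i = 1 \<or> g i (sc s) \<ge> 0"
      using s(2) assms by (auto simp: lab_def sc_def split: if_splits)
    ultimately show "\<exists>b. (\<forall>j<n. b j \<in> {0..1} \<and> \<bar>b j - sc q j\<bar> \<le> 1 / p) \<and> (b i = 1 \<or> g i b \<ge> 0)"
      using near by (intro exI[of _ "sc s"]) blast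
  qed
qed

text \<open>A limit point of grid approximations of mesh \<open>1 / Suc m\<close> works, since
  strict inequalities at the limit would persist at nearby corners. Continuity is sequential and
  sees only the coordinates below \<open>n\<close>, so \<open>g i\<close> cannot depend on the
  others.\<close>

lemma unit_cube_complementarity:
  fixes n :: nat and g :: "nat \<Rightarrow> (nat \<Rightarrow> real) \<Rightarrow> real"
  assumes cont: "\<And>i X x. \<lbrakk>i < n; \<And>j m. j < n \<Longrightarrow> X m j \<in> {0..1}; \<And>j. j < n \<Longrightarrow> x j \<in> {0..1};
      \<And>j. j < n \<Longrightarrow> (\<lambda>m. X m j) \<longlonglongrightarrow> x j\<rbrakk> \<Longrightarrow> (\<lambda>m. g i (X m)) \<longlonglongrightarrow> g i x"
  obtains x where "\<And>i. i < n \<Longrightarrow> x i \<in> {0..1} \<and> (x i = 0 \<or> g i x \<le> 0) \<and> (x i = 1 \<or> g i x \<ge> 0)"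
proof -
  have "\<exists>y. (\<forall>j<n. y j \<in> {0..1}) \<and>
      (\<forall>i<n. \<exists>a. (\<forall>j<n. a j \<in> {0..1} \<and> \<bar>a j - y j\<bar> \<le> 1 / Suc m) \<and> (a i = 0 \<or> g i a \<le> 0)) \<and>
      (\<forall>i<n. \<exists>b. (\<forall>j<n. b j \<in> {0..1} \<and> \<bar>b j - y j\<bar> \<le> 1 / Suc m) \<and> (b i = 1 \<or> g i b \<ge> 0))" for m
    by (rule unit_cube_grid_approx[of "Suc m" n g]) (simp, blast)
  then obtain Y where Y: "\<And>m j. j < n \<Longrightarrow> Y m j \<in> {0..1}"
    and ex: "\<And>i. i < n \<Longrightarrow> \<forall>m. \<exists>a. (\<forall>j<n. a j \<in> {0..1} \<and> \<bar>a j - Y m j\<bar> \<le> 1 / Suc m) \<and> (a i = 0 \<or> g i a \<le> 0)"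
      "\<And>i. i < n \<Longrightarrow> \<forall>m. \<exists>b. (\<forall>j<n. b j \<in> {0..1} \<and> \<bar>b j - Y m j\<bar> \<le> 1 / Suc m) \<and> (b i = 1 \<or> g i b \<ge> 0)"
    by metis
  \<comment> \<open>Bolzano-Weierstrass with one subsequence common to all coordinates; it is used
    for the full index set.\<close>
  have "\<forall>\<delta>\<subseteq>{..<n}. \<exists>l r. strict_mono r \<and>
      (\<forall>\<epsilon>>0. \<forall>\<^sub>F m in sequentially. \<forall>i\<in>\<delta>. dist (Y (r m) i) (l i) < \<epsilon>)"
  proof (rule compact_lemma_general[where unproj = id])
    show "bounded ((\<lambda>x. x k) ` range Y)" if "k \<in> {..<n}" for k
      using that Y by (intro bounded_subset[OF bounded_closed_interval[of 0 1]]) auto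
  qed auto
  then obtain x r where r: "strict_mono r"
    and "\<forall>\<epsilon>>0. \<forall>\<^sub>F m in sequentially. \<forall>i\<in>{..<n}. dist (Y (r m) i) (x i) < \<epsilon>"
    by blast
  then have Ylim: "(\<lambda>m. Y (r m) j) \<longlonglongrightarrow> x j" if "j < n" for j
    using that by (fastforce simp: tendsto_iff elim: eventually_mono)
  have x01: "x j \<in> {0..1}" if "j < n" for j
    by (rule closed_sequentially[OF closed_atLeastAtMost _ Ylim[OF that]]) (use Y that in auto)
  have zero: "(\<lambda>m. 1 / real (Suc (r m))) \<longlonglongrightarrow> 0"
    using LIMSEQ_subseq_LIMSEQ[OF LIMSEQ_inverse_real_of_nat r]
    by (simp add: o_def inverse_eq_divide)
  \<comment> \<open>The corners inherit the limit of the base points, as their distance is at most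
    the mesh width.\<close>
  have lim: "(\<lambda>m. F (r m) j) \<longlonglongrightarrow> x j"
    if "\<And>m. \<bar>F m j - Y m j\<bar> \<le> 1 / Suc m" "j < n" for F :: "nat \<Rightarrow> nat \<Rightarrow> real" and j
  proof -
    have "(\<lambda>m. F (r m) j - Y (r m) j) \<longlonglongrightarrow> 0"
      by (rule Lim_null_comparison[OF _ zero]) (simp only: real_norm_def that(1) eventually_True)
    from tendsto_add[OF this Ylim[OF that(2)]] show ?thesis by simp
  qed
  have "x i = 0 \<or> g i x \<le> 0" if i: "i < n" for i
  proof (rule ccontr)
    assume "\<not> ?thesis"
    then have pos: "x i > 0" "g i x > 0" using x01[OF i] by auto
    obtain A where A: "\<And>m. (\<forall>j<n. A m j \<in> {0..1} \<and> \<bar>A m j - Y m j\<bar> \<le> 1 / Suc m) \<and>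
        (A m i = 0 \<or> g i (A m) \<le> 0)"
      using choice[OF ex(1)[OF i]] by blast
    have Alim: "(\<lambda>m. A (r m) j) \<longlonglongrightarrow> x j" if "j < n" for j
      using lim[of A] A that by blast
    have "(\<lambda>m. g i (A (r m))) \<longlonglongrightarrow> g i x"
      using A x01 Alim by (intro cont[OF i]) blast+
    then have "\<forall>\<^sub>F m in sequentially. A (r m) i > 0 \<and> g i (A (r m)) > 0"
      using pos Alim[OF i] by (intro eventually_conj) (auto dest: order_tendstoD)
    then obtain m where "A (r m) i > 0 \<and> g i (A (r m)) > 0"
      using eventually_happens sequentially_bot by blast
    with A[of "r m"] show False by auto
  qed
  moreover have "x i = 1 \<or> g i x \<ge> 0" if i: "i < n" for i
  proof (rule ccontr)
    assume "\<not> ?thesis"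
    then have neg: "x i < 1" "g i x < 0" using x01[OF i] by auto
    obtain B where B: "\<And>m. (\<forall>j<n. B m j \<in> {0..1} \<and> \<bar>B m j - Y m j\<bar> \<le> 1 / Suc m) \<and>
        (B m i = 1 \<or> g i (B m) \<ge> 0)"
      using choice[OF ex(2)[OF i]] by blast
    have Blim: "(\<lambda>m. B (r m) j) \<longlonglongrightarrow> x j" if "j < n" for j
      using lim[of B] B that by blast
    have "(\<lambda>m. g i (B (r m))) \<longlonglongrightarrow> g i x"
      using B x01 Blim by (intro cont[OF i]) blast+
    then have "\<forall>\<^sub>F m in sequentially. B (r m) i < 1 \<and> g i (B (r m)) < 0"
      using neg Blim[OF i] by (intro eventually_conj) (auto dest: order_tendstoD)
    then obtain m where "B (r m) i < 1 \<and> g i (B (r m)) < 0"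
      using eventually_happens sequentially_bot by blast
    with B[of "r m"] show False by auto
  qed
  ultimately show ?thesis using x01 that by blast
qed

section \<open>Best response to fixed reports of the others\<close>

text \<open>
  Here \<open>s\<close> and \<open>t\<close> are distances from the prediction, \<open>e\<close> is the distance of the deviation from
  the agent's location, and \<open>C - W * (D + \<Delta>) - 1\<close> has the sign of the slope of the cost on the path.
\<close>

lemma linear_fractional_best_response:
  fixes C W D \<Delta> s t e :: real
  assumes "C \<ge> 0" "W \<ge> 0" "\<Delta> > 0" "t \<in> {0..D}" "s \<ge> 0" "e \<ge> \<bar>D - s\<bar>"
    and lo: "t = 0 \<or> C - W * (D + \<Delta>) - 1 \<le> 0"
    and hi: "t = D \<or> C - W * (D + \<Delta>) - 1 \<ge> 0"
  shows "(C + (D - t) / (t + \<Delta>)) / (W + 1 / (t + \<Delta>)) \<le> (C + e / (s + \<Delta>)) / (W + 1 / (s + \<Delta>))"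
proof -
  \<comment> \<open>Clearing the inner fractions exhibits the cost as a quotient of two affine
    functions of the distance from the prediction.\<close>
  have clear: "(C + a / u) / (W + 1 / u) = (C * u + a) / (W * u + 1)" if "u > 0" for a u
    using that by (simp add: divide_simps)
  have pos: "W * (u + \<Delta>) + 1 > 0" if "u \<ge> 0" for u
    using that assms by (intro add_nonneg_pos mult_nonneg_nonneg) auto
  have on_path: "(C * (t + \<Delta>) + (D - t)) / (W * (t + \<Delta>) + 1)
      \<le> (C * (u + \<Delta>) + (D - u)) / (W * (u + \<Delta>) + 1)" if u: "0 \<le> u" "u \<le> D" for u
  proof -
    \<comment> \<open>A positive slope forces \<open>t = 0\<close> and a negative one
      \<open>t = D\<close>, so both factors agree in sign. Their product is the cross-multiplied
      cost difference.\<close>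
    have "0 \<le> (u - t) * (C - W * (D + \<Delta>) - 1)"
      using lo hi u assms(4) by (auto simp: zero_le_mult_iff)
    also have "\<dots> = (C * (u + \<Delta>) + (D - u)) * (W * (t + \<Delta>) + 1)
        - (C * (t + \<Delta>) + (D - t)) * (W * (u + \<Delta>) + 1)"
      by (simp add: algebra_simps)
    finally show ?thesis
      using pos[of t] pos[of u] u assms(4) by (simp add: divide_simps)
  qed
  have "(C * (t + \<Delta>) + (D - t)) / (W * (t + \<Delta>) + 1) \<le> (C * (s + \<Delta>) + e) / (W * (s + \<Delta>) + 1)"
  proof (cases "s \<le> D")
    case True
    have "(C * (s + \<Delta>) + (D - s)) / (W * (s + \<Delta>) + 1) \<le> (C * (s + \<Delta>) + e) / (W * (s + \<Delta>) + 1)"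
      using pos[of s] assms by (intro divide_right_mono) auto
    with on_path[of s] True assms(5) show ?thesis by linarith
  next
    \<comment> \<open>A report farther from the prediction than the agent is no better than the
      truthful one, \<open>u = D\<close>: the cross-multiplied difference is the sum shown
      nonnegative here.\<close>
    case False
    have D: "D \<ge> 0" using assms(4) by simp
    have "0 \<le> C * (s - D) + e * (W * (D + \<Delta>) + 1)"
      using False assms pos[OF D] by (intro add_nonneg_nonneg mult_nonneg_nonneg) auto
    moreover have "e * W * (D + \<Delta>) = e * (W * (D + \<Delta>))" by simp
    ultimately have "(C * (D + \<Delta>)) * (W * (s + \<Delta>) + 1) \<le> (C * (s + \<Delta>) + e) * (W * (D + \<Delta>) + 1)"
      by (simp add: algebra_simps)
    then have "(C * (D + \<Delta>)) / (W * (D + \<Delta>) + 1) \<le> (C * (s + \<Delta>) + e) / (W * (s + \<Delta>) + 1)"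
      using pos[OF D] pos[OF assms(5)] by (simp add: divide_simps)
    with on_path[of D] D show ?thesis by simp
  qed
  then show ?thesis
    using assms by (simp add: clear)
qed

section \<open>Equilibria for positive \<Delta>\<close>

lemma harmonic_cost_fun_upd:
  assumes "Metric_space M d" "\<Delta> > 0" "i \<in> {1..n}"
  shows "harmonic_cost d n \<Delta> p l i (r(i := y)) =
    ((\<Sum>j\<in>{1..n} - {i}. d (l i) (r j) / (d (r j) p + \<Delta>)) + d (l i) y / (d y p + \<Delta>)) /
    ((\<Sum>j\<in>{1..n} - {i}. 1 / (d (r j) p + \<Delta>)) + 1 / (d y p + \<Delta>))"
proof -
  have "d a p + \<Delta> \<noteq> 0" for a
    using Metric_space.nonneg[OF assms(1), of a p] assms(2) by linarith
  then have "harmonic_cost d n \<Delta> p l i (r(i := y)) =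
    (\<Sum>j\<in>{1..n}. d (l i) ((r(i := y)) j) / (d ((r(i := y)) j) p + \<Delta>)) /
    (\<Sum>j\<in>{1..n}. 1 / (d ((r(i := y)) j) p + \<Delta>))"
    by (intro harmonic_cost_regular)
  then show ?thesis
    by (simp only: sum.remove[OF finite_atLeastAtMost assms(3)]) (simp add: add.commute)
qed

text \<open>The unit cube parametrizes the profiles: coordinate \<open>j\<close> is the fraction of
  the path from \<open>p\<close> to \<open>l j\<close> that has been travelled. As
  \<open>\<Delta> > 0\<close>, all denominators are positive and the slopes are continuous.\<close>

lemma harmonic_equilibrium_pos:
  assumes cms: "continuous_metric_space M d" and p: "p \<in> M" and \<Delta>: "\<Delta> > 0"
    and l: "l \<in> {1..n} \<rightarrow> M"
  shows "\<exists>r. pure_nash_equilibrium M n (harmonic_cost d n \<Delta> p l) r"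
proof -
  interpret Metric_space M d
    using cms by (simp add: continuous_metric_space_def)
  define D where "D i = d p (l i)" for i
  have "\<forall>i\<in>{1..n}. \<exists>\<gamma>. shortest_path_between M d p (l i) \<gamma>"
    using cms p l by (auto simp: continuous_metric_space_def)
  then obtain \<gamma> where \<gamma>: "\<And>i. i \<in> {1..n} \<Longrightarrow> shortest_path_between M d p (l i) (\<gamma> i)"
    by metis
  define R where "R x j = \<gamma> j (D j * x j)" for x j
  have scaled: "D j * u \<in> {0..D j}" if "u \<in> {0..1}" for j u
    using that by (auto simp: D_def mult_left_le)
  have path: "\<gamma> j t \<in> M" "d (\<gamma> j t) p = t" "d (l j) (\<gamma> j t) = D j - t"
    if j: "j \<in> {1..n}" and t: "t \<in> {0..D j}" for j t
  proof -
    have ends: "\<gamma> j 0 = p" "\<gamma> j (D j) = l j" and "\<gamma> j \<in> {0..D j} \<rightarrow> M"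
      and iso: "\<And>s t. s \<in> {0..D j} \<Longrightarrow> t \<in> {0..D j} \<Longrightarrow> d (\<gamma> j s) (\<gamma> j t) = \<bar>s - t\<bar>"
      using \<gamma>[OF j] by (auto simp: shortest_path_between_def D_def)
    then show "\<gamma> j t \<in> M" using t by blast
    show "d (\<gamma> j t) p = t" using iso[of t 0] t ends by simp
    show "d (l j) (\<gamma> j t) = D j - t" using iso[of "D j" t] t ends by simp
  qed
  have R: "R x j \<in> M" "d (R x j) p = D j * x j" "d (l j) (R x j) = D j - D j * x j"
    if "j \<in> {1..n}" "x j \<in> {0..1}" for x j
    using path[OF that(1) scaled[OF that(2)]] by (auto simp: R_def)
  define C where "C i x = (\<Sum>j\<in>{1..n} - {i}. d (l i) (R x j) / (d (R x j) p + \<Delta>))" for i x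
  define W where "W i x = (\<Sum>j\<in>{1..n} - {i}. 1 / (d (R x j) p + \<Delta>))" for i x
  \<comment> \<open>Coordinate 0 belongs to no agent and gets a dummy slope.\<close>
  define g where "g i x = (if i = 0 then 0 else C i x - W i x * (D i + \<Delta>) - 1)" for i x
  obtain x where x: "\<And>i. i < Suc n \<Longrightarrow>
      x i \<in> {0..1} \<and> (x i = 0 \<or> g i x \<le> 0) \<and> (x i = 1 \<or> g i x \<ge> 0)"
  proof (rule unit_cube_complementarity[of "Suc n" g])
    fix i x and X :: "nat \<Rightarrow> nat \<Rightarrow> real"
    assume i: "i < Suc n" and X: "\<And>j m. j < Suc n \<Longrightarrow> X m j \<in> {0..1}"
      and x: "\<And>j. j < Suc n \<Longrightarrow> x j \<in> {0..1}"
      and lim: "\<And>j. j < Suc n \<Longrightarrow> (\<lambda>m. X m j) \<longlonglongrightarrow> x j"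
    have dp: "(\<lambda>m. d (R (X m) j) p) \<longlonglongrightarrow> d (R x j) p" if j: "j \<in> {1..n}" for j
      using j R(2)[OF j] X x lim by (auto intro!: tendsto_intros simp: less_Suc_eq_le)
    \<comment> \<open>The distance to \<open>l i\<close> is 1-Lipschitz and \<open>R\<close> moves
      along path \<open>j\<close> at speed \<open>D j\<close>. Index 0 is excluded because
      \<open>l 0\<close> need not lie in \<open>M\<close>.\<close>
    have dl: "(\<lambda>m. d (l i) (R (X m) j)) \<longlonglongrightarrow> d (l i) (R x j)"
      if j: "j \<in> {1..n}" and "i \<noteq> 0" for j
    proof -
      have jn: "j < Suc n" and li: "l i \<in> M" using j i \<open>i \<noteq> 0\<close> l by auto
      have bound: "\<bar>d (l i) (R (X m) j) - d (l i) (R x j)\<bar> \<le> D j * \<bar>X m j - x j\<bar>" for m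
      proof -
        have "\<bar>d (l i) (R (X m) j) - d (l i) (R x j)\<bar> \<le> d (R (X m) j) (R x j)"
          using mdist_reverse_triangle[OF R(1)[of j "X m", OF j X[OF jn]] li R(1)[of j x, OF j x[OF jn]]]
          by (simp add: commute)
        also have "\<dots> = \<bar>D j * X m j - D j * x j\<bar>"
          using \<gamma>[OF j] scaled[OF X[OF jn]] scaled[OF x[OF jn]]
          unfolding R_def shortest_path_between_def D_def by blast
        also have "\<dots> = D j * \<bar>X m j - x j\<bar>"
          by (simp add: D_def abs_mult flip: right_diff_distrib)
        finally show ?thesis .
      qed
      have "(\<lambda>m. D j * \<bar>X m j - x j\<bar>) \<longlonglongrightarrow> 0"
        using lim[OF jn] by (auto intro!: tendsto_eq_intros)
      then have "(\<lambda>m. d (l i) (R (X m) j) - d (l i) (R x j)) \<longlonglongrightarrow> 0"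
        by (rule Lim_null_comparison[rotated]) (simp only: real_norm_def bound eventually_True)
      then show ?thesis by (rule LIM_zero_cancel)
    qed
    have nz: "d a p + \<Delta> \<noteq> 0" for a
      using nonneg[of a p] \<Delta> by linarith
    show "(\<lambda>m. g i (X m)) \<longlonglongrightarrow> g i x"
    proof (cases "i = 0")
      case False
      then show ?thesis
        unfolding g_def C_def W_def if_not_P[OF False]
        by (intro tendsto_intros dp dl nz) auto
    qed (simp add: g_def)
  qed auto
  have "pure_nash_equilibrium M n (harmonic_cost d n \<Delta> p l) (R x)"
    unfolding pure_nash_equilibrium_def
  proof (intro conjI ballI)
    show "R x \<in> {1..n} \<rightarrow> M"
      using R(1) x by (auto simp: less_Suc_eq_le)
  next
    fix i y assume i: "i \<in> {1..n}" and y: "y \<in> M"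
    have xi: "x i \<in> {0..1}" and li: "l i \<in> M" and "i \<noteq> 0"
      and gi: "x i = 0 \<or> g i x \<le> 0" "x i = 1 \<or> g i x \<ge> 0"
      using x[of i] i l by auto
    have nonneg': "d a p + \<Delta> \<ge> 0" for a
      using nonneg[of a p] \<Delta> by linarith
    \<comment> \<open>Writing the equilibrium itself as an update at \<open>i\<close> gives both
      sides the same constants \<open>C i x\<close> and \<open>W i x\<close>.\<close>
    have "harmonic_cost d n \<Delta> p l i ((R x)(i := R x i)) \<le> harmonic_cost d n \<Delta> p l i ((R x)(i := y))"
      unfolding harmonic_cost_fun_upd[OF Metric_space_axioms \<Delta> i] R(2,3)[of i x, OF i xi]
        C_def[symmetric] W_def[symmetric]
    proof (rule linear_fractional_best_response[OF _ _ \<Delta> scaled[OF xi]])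
      show "C i x \<ge> 0" "W i x \<ge> 0"
        by (auto simp: C_def W_def intro!: sum_nonneg divide_nonneg_nonneg nonneg')
      show "\<bar>D i - d y p\<bar> \<le> d (l i) y"
        using mdist_reverse_triangle[OF li p y] by (simp add: D_def commute)
      show "D i * x i = 0 \<or> C i x - W i x * (D i + \<Delta>) - 1 \<le> 0"
        "D i * x i = D i \<or> C i x - W i x * (D i + \<Delta>) - 1 \<ge> 0"
        using gi \<open>i \<noteq> 0\<close> by (auto simp: g_def)
    qed simp
    then show "harmonic_cost d n \<Delta> p l i (R x) \<le> harmonic_cost d n \<Delta> p l i ((R x)(i := y))"
      by simp
  qed
  then show ?thesis by blast
qed

section \<open>All \<Delta>, including the degenerate case\<close>

theorem theorem3p5:
  fixes M :: "'a set" and d :: "'a \<Rightarrow> 'a \<Rightarrow> real"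
    and n :: nat and p :: 'a and \<Delta> :: real and l :: "nat \<Rightarrow> 'a"
  assumes "continuous_metric_space M d"
    and "n \<ge> 1"
    and "p \<in> M"
    and "\<Delta> \<ge> 0"
    and "l \<in> {1..n} \<rightarrow> M"
  shows "\<exists>r. pure_nash_equilibrium M n (harmonic_cost d n \<Delta> p l) r"
proof -
  interpret Metric_space M d
    using assms(1) by (simp add: continuous_metric_space_def)
  consider "\<Delta> > 0" | "\<Delta> = 0" "n \<ge> 2" | "\<Delta> = 0" "n = 1"
    using assms by linarith
  then show ?thesis
  proof cases
    case 1
    then show ?thesis by (rule harmonic_equilibrium_pos[OF assms(1,3) _ assms(5)])
  next
    case 2
    have "harmonic_cost d n 0 p l i (\<lambda>_. p) \<le> harmonic_cost d n 0 p l i ((\<lambda>_. p)(i := y))"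
      if i: "i \<in> {1..n}" and y: "y \<in> M" for i y
    proof -
      \<comment> \<open>Agent \<open>k\<close> reports \<open>p\<close> in both profiles, so the
        facility is surely at \<open>p\<close> before and after the deviation.\<close>
      obtain k where k: "k \<in> {1..n}" "k \<noteq> i"
        using \<open>n \<ge> 2\<close> by (cases "i = 1") (auto intro: that[of 1] that[of 2])
      then show ?thesis
        using y \<open>p \<in> M\<close> by (simp add: harmonic_cost_singular[OF Metric_space_axioms, of p _ n k])
    qed
    then show ?thesis
      using \<open>\<Delta> = 0\<close> \<open>p \<in> M\<close> unfolding pure_nash_equilibrium_def by (intro exI[of _ "\<lambda>_. p"]) auto
  next
    case 3
    \<comment> \<open>A lone agent's report is chosen with probability 1, whether or not it equals
      \<open>p\<close>; reporting the truth then costs 0.\<close>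
    have "harmonic_cost d n \<Delta> p l 1 r = d (l 1) (r 1)" for r
      using harmonic_prob_sum[OF Metric_space_axioms assms(2,4), of p r] \<open>n = 1\<close>
      by (simp add: harmonic_cost_def)
    then show ?thesis
      using assms(5) \<open>n = 1\<close> unfolding pure_nash_equilibrium_def by (intro exI[of _ l]) auto
  qed
qed

end
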